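(* Let $\mathcal{M}$ be a finite set of goods. Every separable utility function $u:\mathbb{R}_{\ge0}^{\mathcal{M}}\to\mathbb{R}_{\ge0}$ satisfying the attainment assumption (stated in the context) is $\Sigma$-Gale-substitutes.
   Context: Utility function: a function $u:\mathbb{R}_{\ge 0}^{\mathcal{M}}\to\mathbb{R}_{\ge 0}$ with $u(\mathbf{0})=0$ that is concave, continuous, monotone non-decreasing, and satisfies $u(\mathbf{x})>0$ for some $\mathbf{x}$. It is separable if $u(\mathbf{x})=\sum_{j\in\mathcal{M}}v_j(x_j)$ for univariate functions $v_j:\mathbb{R}_{\ge0}\to\mathbb{R}$. Attainment assumption (standing assumption on utility functions): for any $\mathbf{p}\in\mathbb{R}_{\ge0}^{\mathcal{M}}$ and $b\ge0$, if there is a sequence $\{\mathbf{x}^{(k)}\}_{k\ge1}\subset\mathbb{R}_{\ge0}^{\mathcal{M}}$ such that $\langle\mathbf{p},\mathbf{x}^{(k)}\rangle\to b$ and $u(\mathbf{x}^{(k)})\to M<\infty$, then there exists $\mathbf{x}^*\in\mathbb{R}_{\ge0}^{\mathcal{M}}$ with $u(\mathbf{x}^* )=M$ and $\langle\mathbf{p},\mathbf{x}^*\rangle\le b$. Gale demand: for $\mathbf{q}\in\mathbb{R}_{\ge0}^{\mathcal{M}}$, $b>0$, $\mathcal{GD}^u(\mathbf{q},b)=\arg\max_{\mathbf{y}\in\mathbb{R}_{\ge0}^{\mathcal{M}}}\ b\log u(\mathbf{y})-\langle\mathbf{q},\mathbf{y}\rangle$ (with $\log0=-\infty$). Its price domain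 is $\operatorname{pdom}(u)=\{\mathbf{q}\in\mathbb{R}_{\ge0}^{\mathcal{M}}:\exists b>0,\ \sup_{\mathbf{y}\in\mathbb{R}_{\ge0}^{\mathcal{M}}} b\log u(\mathbf{y})-\langle\mathbf{q},\mathbf{y}\rangle<+\infty\}$. $u$ is Gale-substitutes if: (i) for any $b>0$, $\mathbf{q},\mathbf{q}'\in\operatorname{pdom}(u)$ with $\mathbf{q}\ge\mathbf{q}'$ and $\mathbf{y}\in\mathcal{GD}^u(\mathbf{q},b)$, there exists $\mathbf{y}'\in\mathcal{GD}^u(\mathbf{q}',b)$ such that $y'_j\le y_j$ whenever $q'_j=q_j$; and (ii) for any $b\ge b'>0$, $\mathbf{q}\in\operatorname{pdom}(u)$ and $\mathbf{y}\in\mathcal{GD}^u(\mathbf{q},b)$, there exists $\mathbf{y}'\in\mathcal{GD}^u(\mathbf{q},b')$ with $\mathbf{y}'\le\mathbf{y}$. $u$ is $\Sigma$-Gale-substitutes if it is Gale-substitutes and moreover: if $\mathbf{0}\in\operatorname{pdom}(u)$, $b>0$ and $\mathbf{q}\in\mathbb{R}_{\ge0}^{\mathcal{M}}$, then for any $\mathbf{y}\in\mathcal{GD}^u(\mathbf{0},b)$ there exists $\mathbf{y}'\in\mathcal{GD}^u(\mathbf{q},b)$ with $\mathbf{y}'\le\mathbf{y}$. *)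

theory Defs
  imports "HOL-Analysis.Analysis"
begin

text \<open>
  Goods are the elements of a finite type \<open>'m\<close>, and bundles and prices are vectors
  \<open>real ^ 'm\<close>, ordered componentwise. The nonnegative orthant is \<open>{0..}\<close>; functions on it are
  total functions on \<open>real ^ 'm\<close> of which only the values on \<open>{0..}\<close> are used. Types are nonempty,
  but for an empty set of goods there is no utility function: it would have to vanish at \<open>0\<close> and be
  positive somewhere.
\<close>

definition utility :: "(real ^ 'm::finite \<Rightarrow> real) \<Rightarrow> bool" where
  "utility u \<longleftrightarrow>
     (\<forall>x\<in>{0..}. u x \<ge> 0) \<and> u 0 = 0 \<and>
     concave_on {0..} u \<and> continuous_on {0..} u \<and> mono_on {0..} u \<and>
     (\<exists>x\<in>{0..}. u x > 0)"

definition separable :: "(real ^ 'm::finite \<Rightarrow> real) \<Rightarrow> bool" where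
  "separable u \<longleftrightarrow> (\<exists>v :: 'm \<Rightarrow> real \<Rightarrow> real. \<forall>x\<in>{0..}. u x = (\<Sum>j\<in>UNIV. v j (x $ j)))"

definition attainment :: "(real ^ 'm::finite \<Rightarrow> real) \<Rightarrow> bool" where
  "attainment u \<longleftrightarrow>
     (\<forall>p\<in>{0..}. \<forall>b\<ge>0. \<forall>(x :: nat \<Rightarrow> real ^ 'm) M.
        (\<forall>k. x k \<in> {0..}) \<and> (\<lambda>k. p \<bullet> x k) \<longlonglongrightarrow> b \<and> (\<lambda>k. u (x k)) \<longlonglongrightarrow> M \<longrightarrow>
        (\<exists>x'\<in>{0..}. u x' = M \<and> p \<bullet> x' \<le> b))"

text \<open>
  The objective \<open>b log u(y) - \<langle>q, y\<rangle>\<close> is extended-real valued because of the convention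
  \<open>log 0 = -\<infinity>\<close> (in the library, \<open>ln 0 = 0\<close>).
\<close>

definition ext_log :: "real \<Rightarrow> ereal" where
  "ext_log t = (if t = 0 then -\<infinity> else ereal (ln t))"

definition gale_objective ::
  "(real ^ 'm::finite \<Rightarrow> real) \<Rightarrow> real ^ 'm \<Rightarrow> real \<Rightarrow> real ^ 'm \<Rightarrow> ereal" where
  "gale_objective u q b y = ereal b * ext_log (u y) - ereal (q \<bullet> y)"

definition gale_demand ::
  "(real ^ 'm::finite \<Rightarrow> real) \<Rightarrow> real ^ 'm \<Rightarrow> real \<Rightarrow> (real ^ 'm) set" where
  "gale_demand u q b = {y. is_arg_max (gale_objective u q b) (\<lambda>z. z \<in> {0..}) y}"

definition pdom :: "(real ^ 'm::finite \<Rightarrow> real) \<Rightarrow> (real ^ 'm) set" where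
  "pdom u = {q \<in> {0..}. \<exists>b>0. (SUP y\<in>{0..}. gale_objective u q b y) < \<infinity>}"

definition gale_substitutes :: "(real ^ 'm::finite \<Rightarrow> real) \<Rightarrow> bool" where
  "gale_substitutes u \<longleftrightarrow>
     (\<forall>b>0. \<forall>q\<in>pdom u. \<forall>q'\<in>pdom u. q \<ge> q' \<longrightarrow>
        (\<forall>y\<in>gale_demand u q b. \<exists>y'\<in>gale_demand u q' b. \<forall>j. q' $ j = q $ j \<longrightarrow> y' $ j \<le> y $ j)) \<and>
     (\<forall>b b'. b \<ge> b' \<and> b' > 0 \<longrightarrow>
        (\<forall>q\<in>pdom u. \<forall>y\<in>gale_demand u q b. \<exists>y'\<in>gale_demand u q b'. y' \<le> y))"

definition sigma_gale_substitutes :: "(real ^ 'm::finite \<Rightarrow> real) \<Rightarrow> bool" where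
  "sigma_gale_substitutes u \<longleftrightarrow>
     gale_substitutes u \<and>
     (0 \<in> pdom u \<longrightarrow>
        (\<forall>b>0. \<forall>q\<in>{0..}. \<forall>y\<in>gale_demand u 0 b. \<exists>y'\<in>gale_demand u q b. y' \<le> y))"

end

theory Submission
  imports Defs
begin

text \<open>
  A bundle \<open>y\<close> is in the Gale demand at \<open>(q, b)\<close> iff it maximizes \<open>u(z) exp(-\<langle>q, z\<rangle>/b)\<close>, and by
  concavity iff it maximizes the linearization \<open>u(z) - l \<langle>q, z\<rangle>\<close> with \<open>l = u(y)/b\<close>. For separable
  \<open>u\<close> this decouples: each \<open>y\<^sub>j\<close> maximizes \<open>v\<^sub>j(t) - l q\<^sub>j t\<close>, and such maximizers decrease in the
  slope. So two demands are compared through their multipliers \<open>l\<close>, which cannot decrease when prices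
  or the budget fall. If the multiplier increases, the required inequalities are automatic; if it stays
  the same, the intermediate value theorem on a segment of maximizers of the linearization adjusts the
  utility level to the one that belongs to this multiplier.
  Demand is nonempty on the price domain because consuming more than \<open>b/q\<^sub>j\<close> of a good never pays,
  while \<open>q\<^sub>j = 0\<close> forces \<open>v\<^sub>j\<close> to be bounded, hence to attain its supremum.
\<close>

section \<open>Univariate maximizers at a linear price\<close>

definition lin_demand :: "(real \<Rightarrow> real) \<Rightarrow> real \<Rightarrow> real set" where
  "lin_demand f p = {x. 0 \<le> x \<and> (\<forall>t\<ge>0. f t - p * t \<le> f x - p * x)}"

text \<open>Adding the two optimality inequalities cancels the values of \<open>f\<close>.
  Strictness of \<open>p < p'\<close> makes the conclusion hold for every choice of maximizers, not
  only for a suitable one.\<close>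

lemma lin_demand_antimono:
  assumes "x \<in> lin_demand f p" "x' \<in> lin_demand f p'" "p < p'"
  shows "x' \<le> x"
proof -
  have "f x' - p * x' \<le> f x - p * x" "f x - p' * x \<le> f x' - p' * x'"
    using assms by (auto simp: lin_demand_def)
  then have "(p' - p) * x' \<le> (p' - p) * x" by (simp add: algebra_simps)
  then show ?thesis using assms(3) by simp
qed

text \<open>The alternative \<open>p = 0\<close> serves free goods, whose slope stays zero whatever
  the multiplier is: there \<open>x\<close> maximizes \<open>f\<close> itself.\<close>

lemma lin_demand_value_antimono:
  assumes "x \<in> lin_demand f p" "x' \<in> lin_demand f p'" "p < p' \<or> p = 0" "mono_on {0..} f"
  shows "f x' \<le> f x"
proof (cases "p = 0")
  case True
  then show ?thesis using assms by (auto simp: lin_demand_def)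
next
  case False
  then have "x' \<le> x" using lin_demand_antimono assms by blast
  then show ?thesis using assms by (auto simp: lin_demand_def mono_on_def)
qed

lemma vec_nonneg_iff: "0 \<le> (x :: real ^ 'm::finite) \<longleftrightarrow> (\<forall>j. 0 \<le> x $ j)"
  by (simp add: less_eq_vec_def)

lemma inner_vec_sum: "(q :: real ^ 'm::finite) \<bullet> x = (\<Sum>j\<in>UNIV. q $ j * x $ j)"
  by (simp add: inner_vec_def)

section \<open>Separable utilities and their restrictions to the axes\<close>

text \<open>The normalization \<open>v_zero\<close> makes \<open>v j\<close> the restriction of
  \<open>u\<close> to the axis of good \<open>j\<close>, so that monotonicity of \<open>v j\<close>
  and its bounds can be read off from \<open>u\<close>.\<close>

locale separable_utility =
  fixes u :: "real ^ 'm::finite \<Rightarrow> real" and v :: "'m \<Rightarrow> real \<Rightarrow> real"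
  assumes utility: "utility u"
    and sum_eq: "x \<in> {0..} \<Longrightarrow> u x = (\<Sum>j\<in>UNIV. v j (x $ j))"
    and v_zero: "v j 0 = 0"
begin

lemma sum_eq_split:
  "x \<in> {0..} \<Longrightarrow> u x = (\<Sum>j\<in>S. v j (x $ j)) + (\<Sum>j\<in>-S. v j (x $ j))"
  using sum.union_disjoint[of S "-S" "\<lambda>j. v j (x $ j)"] by (simp add: sum_eq Compl_partition)

lemma u_nonneg: "x \<in> {0..} \<Longrightarrow> 0 \<le> u x"
  and u_concave: "concave_on {0..} u"
  and u_continuous: "continuous_on {0..} u"
  and u_mono: "mono_on {0..} u"
  and u_pos_ex: "\<exists>x\<in>{0..}. 0 < u x"
  using utility by (auto simp: utility_def)

lemma u_axis: "0 \<le> t \<Longrightarrow> u (axis j t) = v j t"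
proof -
  assume t: "0 \<le> t"
  then have "u (axis j t) = (\<Sum>i\<in>UNIV. v i (axis j t $ i))"
    by (intro sum_eq) (auto simp: vec_nonneg_iff axis_def)
  also have "\<dots> = (\<Sum>i\<in>UNIV. if i = j then v j t else 0)"
    by (intro sum.cong) (auto simp: axis_def v_zero)
  finally show ?thesis by simp
qed

lemma v_mono: "mono_on {0..} (v j)"
proof (rule mono_onI)
  fix s t :: real assume "s \<in> {0..}" "t \<in> {0..}" "s \<le> t"
  then have "u (axis j s) \<le> u (axis j t)"
    by (intro mono_onD[OF u_mono]) (auto simp: vec_nonneg_iff less_eq_vec_def axis_def)
  then show "v j s \<le> v j t" using \<open>s \<in> {0..}\<close> \<open>t \<in> {0..}\<close> by (simp add: u_axis)
qed

lemma u_concaveD: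
  assumes "x \<in> {0..}" "y \<in> {0..}" "0 \<le> t" "t \<le> 1"
  shows "(1 - t) * u x + t * u y \<le> u ((1 - t) *\<^sub>R x + t *\<^sub>R y)"
  using concave_onD[OF u_concave, of t x y] assms by auto

lemma gale_objective_eq:
  assumes "0 < b"
  shows "gale_objective u q b y =
    (if u y = 0 then -\<infinity> else ereal (b * ln (u y) - q \<bullet> y))"
  using assms by (auto simp: gale_objective_def ext_log_def)

section \<open>Gale demand as coordinatewise maximization\<close>

text \<open>Dividing the objective by \<open>b\<close> and exponentiating preserves the order and
  turns the value minus infinity into 0, which removes the extended reals. A maximizer has positive
  utility because some bundle does.\<close>

lemma gale_demand_iff_exp:
  assumes "0 < b"
  shows "y \<in> gale_demand u q b \<longleftrightarrow>
    y \<in> {0..} \<and> 0 < u y \<and> (\<forall>z\<in>{0..}. u z * exp (- (q \<bullet> z) / b) \<le> u y * exp (- (q \<bullet> y) / b))"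
    (is "_ \<longleftrightarrow> ?R")
proof -
  have pos_cmp: "b * ln (u z) - q \<bullet> z \<le> b * ln (u y) - q \<bullet> y \<longleftrightarrow>
      u z * exp (- (q \<bullet> z) / b) \<le> u y * exp (- (q \<bullet> y) / b)" if "0 < u y" "0 < u z" for y z
  proof -
    have "b * ln (u z) - q \<bullet> z \<le> b * ln (u y) - q \<bullet> y \<longleftrightarrow>
        ln (u z) + - (q \<bullet> z) / b \<le> ln (u y) + - (q \<bullet> y) / b"
    proof -
      have "b * ln (u x) - q \<bullet> x = b * (ln (u x) + - (q \<bullet> x) / b)" for x
        using assms by (simp add: right_diff_distrib)
      then show ?thesis using assms by (simp only: mult_le_cancel_left_pos)
    qed
    also have "\<dots> \<longleftrightarrow> exp (ln (u z) + - (q \<bullet> z) / b) \<le> exp (ln (u y) + - (q \<bullet> y) / b)" by simp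
    finally show ?thesis using that by (simp only: exp_add exp_ln)
  qed
  obtain w where w: "w \<in> {0..}" "0 < u w" using u_pos_ex by blast
  have "y \<in> gale_demand u q b \<longleftrightarrow> y \<in> {0..} \<and>
      (\<forall>z\<in>{0..}. gale_objective u q b z \<le> gale_objective u q b y)"
    by (auto simp: gale_demand_def is_arg_max_def not_less)
  also have "\<dots> \<longleftrightarrow> ?R"
  proof (cases "y \<in> {0..} \<and> 0 < u y")
    case True
    have "gale_objective u q b z \<le> gale_objective u q b y \<longleftrightarrow>
        u z * exp (- (q \<bullet> z) / b) \<le> u y * exp (- (q \<bullet> y) / b)" if "z \<in> {0..}" for z
      using pos_cmp[of y z] True u_nonneg[OF that] assms
      by (cases "u z = 0") (auto simp: gale_objective_eq)
    then show ?thesis using True by blast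
  next
    case False
    have "\<not> gale_objective u q b w \<le> gale_objective u q b y" if "y \<in> {0..}"
      using False that u_nonneg[OF that] w assms by (simp add: gale_objective_eq)
    then show ?thesis using False w by blast
  qed
  finally show ?thesis .
qed

text \<open>From right to left, \<open>exp s >= 1 + s\<close> at \<open>s = u z / u y - 1\<close>
  says that the logarithm lies below its tangent at \<open>u y\<close>. From left to right, the
  linear inequality is the first-order condition at \<open>y\<close> in the direction of
  \<open>z\<close>, with concavity bounding \<open>u\<close> from below on the segment.\<close>

lemma maximizer_exp_iff_linear:
  assumes b: "0 < b" and y: "y \<in> {0..}" "0 < u y"
  shows "(\<forall>z\<in>{0..}. u z * exp (- (q \<bullet> z) / b) \<le> u y * exp (- (q \<bullet> y) / b)) \<longleftrightarrow>
    (\<forall>z\<in>{0..}. u z - u y / b * (q \<bullet> z) \<le> u y - u y / b * (q \<bullet> y))" (is "?L \<longleftrightarrow> ?R")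
proof
  assume R: ?R
  show ?L
  proof
    fix z :: "real ^ 'm" assume "z \<in> {0..}"
    then have "(u z - u y / b * (q \<bullet> z)) / u y \<le> (u y - u y / b * (q \<bullet> y)) / u y"
      using R y by (intro divide_right_mono) auto
    then have *: "u z / u y - 1 - (q \<bullet> z) / b \<le> - (q \<bullet> y) / b"
      using y b by (simp add: diff_divide_distrib)
    have "u z / u y \<le> exp (u z / u y - 1)" using exp_ge_add_one_self[of "u z / u y - 1"] by simp
    then have "u z \<le> u y * exp (u z / u y - 1)" using y by (simp add: field_simps)
    then have "u z * exp (- (q \<bullet> z) / b) \<le> u y * exp (u z / u y - 1) * exp (- (q \<bullet> z) / b)" by simp
    also have "\<dots> = u y * exp (u z / u y - 1 - (q \<bullet> z) / b)"
      by (simp add: mult.assoc flip: exp_add)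
    also have "\<dots> \<le> u y * exp (- (q \<bullet> y) / b)" using * y by simp
    finally show "u z * exp (- (q \<bullet> z) / b) \<le> u y * exp (- (q \<bullet> y) / b)" .
  qed
next
  assume L: ?L
  show ?R
  proof
    fix z :: "real ^ 'm" assume z: "z \<in> {0..}"
    define d where "d = u z - u y"
    define e where "e = (q \<bullet> z - q \<bullet> y) / b"
    \<comment> \<open>Here \<open>d\<close> is the gain in utility and \<open>e\<close> the increase
      in cost over \<open>b\<close> from \<open>y\<close> to \<open>z\<close>. Moving only a
      fraction \<open>t\<close> of the way leaves the second-order error \<open>t * (d * e)\<close>,
      which vanishes as \<open>t\<close> tends to 0.\<close>
    have step: "d - u y * e \<le> t * (d * e)" if t: "0 < t" "t \<le> 1" for t
    proof -
      let ?w = "(1 - t) *\<^sub>R y + t *\<^sub>R z"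
      have w: "?w \<in> {0..}" using y z t by (auto simp: vec_nonneg_iff)
      have nn: "0 \<le> u y + t * d"
        using u_nonneg[OF y(1)] u_nonneg[OF z] t convex_bound_le[of "- u y" 0 "- u z" "1 - t" t]
        by (simp add: d_def algebra_simps)
      have "u y + t * d \<le> u ?w" using u_concaveD[OF y(1) z, of t] t by (simp add: d_def algebra_simps)
      have "- (q \<bullet> ?w) / b = - (q \<bullet> y) / b - t * e"
        using b by (simp add: e_def inner_add_right inner_diff_right field_simps)
      then have "u ?w * exp (- (q \<bullet> y) / b - t * e) \<le> u y * exp (- (q \<bullet> y) / b)"
        using L w by metis
      then have "u ?w * exp (- (t * e)) \<le> u y" by (simp add: exp_diff exp_minus field_simps)
      moreover have "(u y + t * d) * (1 - t * e) \<le> (u y + t * d) * exp (- (t * e))"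
        using exp_ge_add_one_self[of "- (t * e)"] nn by (intro mult_left_mono) auto
      moreover have "\<dots> \<le> u ?w * exp (- (t * e))"
        using \<open>u y + t * d \<le> u ?w\<close> by simp
      ultimately have "(u y + t * d) * (1 - t * e) \<le> u y" by linarith
      then have "t * (d - u y * e) \<le> t * (t * (d * e))" by (simp add: algebra_simps)
      then show ?thesis using t by simp
    qed
    have "((\<lambda>t. t * (d * e)) \<longlongrightarrow> 0 * (d * e)) (at_right 0)" by (intro tendsto_intros)
    moreover have "\<forall>\<^sub>F t in at_right 0. d - u y * e \<le> t * (d * e)"
      unfolding eventually_at_right_field using step by (intro exI[of _ 1]) auto
    ultimately have "d - u y * e \<le> 0 * (d * e)"
      by (rule tendsto_lowerbound) simp
    moreover have "u y * e = u y / b * (q \<bullet> z) - u y / b * (q \<bullet> y)"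
      by (simp add: e_def diff_divide_distrib right_diff_distrib)
    ultimately show "u z - u y / b * (q \<bullet> z) \<le> u y - u y / b * (q \<bullet> y)"
      by (simp add: d_def)
  qed
qed

text \<open>The linearized objective is a sum of univariate terms, and replacing a single coordinate
  of \<open>y\<close> tests one term at a time.\<close>

lemma linear_maximizer_iff_lin_demand:
  assumes y: "y \<in> {0..}"
  shows "(\<forall>z\<in>{0..}. u z - l * (q \<bullet> z) \<le> u y - l * (q \<bullet> y)) \<longleftrightarrow>
    (\<forall>j. y $ j \<in> lin_demand (v j) (l * q $ j))" (is "?L \<longleftrightarrow> ?R")
proof -
  have eq: "u z - l * (q \<bullet> z) = (\<Sum>j\<in>UNIV. v j (z $ j) - l * q $ j * z $ j)" if "z \<in> {0..}" for z
    using that by (simp add: sum_eq inner_vec_sum sum_subtractf sum_distrib_left mult.assoc)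
  show ?thesis
  proof
    assume ?R
    then show ?L using y by (auto simp: eq lin_demand_def vec_nonneg_iff intro!: sum_mono)
  next
    assume L: ?L
    have "v j t - l * q $ j * t \<le> v j (y $ j) - l * q $ j * y $ j" if t: "0 \<le> t" for j t
    proof -
      define z where "z = (\<chi> i. if i = j then t else y $ i)"
      have z: "z \<in> {0..}" using y t by (auto simp: z_def vec_nonneg_iff)
      let ?g = "\<lambda>x i. v i (x $ i) - l * q $ i * x $ i"
      have "(\<Sum>i\<in>UNIV. ?g z i) \<le> (\<Sum>i\<in>UNIV. ?g y i)" using L z y eq by metis
      moreover have "(\<Sum>i\<in>UNIV. ?g x i) = ?g x j + (\<Sum>i\<in>UNIV - {j}. ?g x i)" for x
        by (simp add: sum.remove)
      moreover have "(\<Sum>i\<in>UNIV - {j}. ?g z i) = (\<Sum>i\<in>UNIV - {j}. ?g y i)"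
        by (intro sum.cong) (auto simp: z_def)
      ultimately have "?g z j \<le> ?g y j" by simp
      then show ?thesis by (simp add: z_def)
    qed
    then show ?R using y by (simp add: lin_demand_def vec_nonneg_iff)
  qed
qed

text \<open>The multiplier \<open>u y / b\<close> depends on \<open>y\<close> itself: coordinatewise
  maximizers for a multiplier \<open>l\<close> form a Gale demand once their utility is
  \<open>l * b > 0\<close>. Constructing a demand therefore means hitting a utility level as
  well.\<close>

lemma gale_demand_iff:
  assumes "0 < b"
  shows "y \<in> gale_demand u q b \<longleftrightarrow>
    y \<in> {0..} \<and> 0 < u y \<and> (\<forall>j. y $ j \<in> lin_demand (v j) (u y / b * q $ j))"
  using gale_demand_iff_exp[OF assms, of y q] maximizer_exp_iff_linear[OF assms, of y q]
    linear_maximizer_iff_lin_demand[of y "u y / b" q] by argo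

section \<open>Comparison of demands through their multipliers\<close>

text \<open>If the multiplier rises strictly, so do the slopes of the goods in \<open>S\<close> with
  positive price, and \<open>y'\<close> is already below \<open>y\<close> there; free goods can be
  cut down to \<open>y\<close> at no loss. If it stays the same, \<open>tie\<close> lets a mixture
  of \<open>y\<close> and \<open>y'\<close> reach the utility \<open>u y'\<close>.\<close>

lemma gale_demand_lowerI:
  assumes "0 < b" "0 < b'" "y \<in> gale_demand u q b" "y' \<in> gale_demand u q' b'"
    and q': "\<And>j. 0 \<le> q' $ j"
    and S: "\<And>j. j \<in> S \<Longrightarrow> q' $ j = q $ j"
    and le: "u y / b \<le> u y' / b'"
    and tie: "u y / b = u y' / b' \<Longrightarrow> (\<Sum>j\<in>S. v j (y' $ j)) \<le> (\<Sum>j\<in>S. v j (y $ j))"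
  shows "\<exists>z\<in>gale_demand u q' b'. \<forall>j\<in>S. z $ j \<le> y $ j"
proof -
  have y: "y \<in> {0..}" "0 < u y" "\<And>j. y $ j \<in> lin_demand (v j) (u y / b * q $ j)"
    and y': "y' \<in> {0..}" "0 < u y'" "\<And>j. y' $ j \<in> lin_demand (v j) (u y' / b' * q' $ j)"
    using assms(3,4) gale_demand_iff assms(1,2) by blast+
  define w where "w = (\<chi> j. if j \<in> S then min (y' $ j) (y $ j) else y' $ j)"
  have w: "w \<in> {0..}" "w \<le> y'" "\<forall>j\<in>S. w $ j \<le> y $ j"
    using y y' by (auto simp: w_def vec_nonneg_iff less_eq_vec_def)
  show ?thesis
  proof (cases "u y / b = u y' / b'")
    case False
    then have lt: "u y / b < u y' / b'" using le by simp
    have *: "w $ j \<in> lin_demand (v j) (u y' / b' * q' $ j) \<and> v j (w $ j) = v j (y' $ j)" for j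
    proof (cases "j \<in> S \<and> y $ j < y' $ j")
      case True
      \<comment> \<open>Only a free good can exceed \<open>y\<close> on \<open>S\<close>. Both
        \<open>y $ j\<close> and \<open>y' $ j\<close> then maximize \<open>v j\<close>, so the cut
        changes no value.\<close>
      have "q' $ j = 0"
      proof (rule ccontr)
        assume "q' $ j \<noteq> 0"
        then have "0 < q' $ j" using q'[of j] by simp
        then have "u y / b * q $ j < u y' / b' * q' $ j" using lt S True mult_strict_right_mono by metis
        then show False using lin_demand_antimono[OF y(3) y'(3)] True by force
      qed
      then show ?thesis
        using True y(3)[of j] y'(3)[of j] S[of j]
        by (auto simp: w_def lin_demand_def min_def intro!: antisym)
    qed (use y'(3)[of j] in \<open>auto simp: w_def min_def\<close>)
    then have "u w = u y'" using w y' by (simp add: sum_eq)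
    then have "w \<in> gale_demand u q' b'"
      using w * y' gale_demand_iff[OF assms(2)] by auto
    then show ?thesis using w by blast
  next
    case True
    define z where "z = (\<chi> j. if j \<in> S then y $ j else y' $ j)"
    have z: "z \<in> {0..}" using y y' by (auto simp: z_def vec_nonneg_iff)
    then have "u y' \<le> u z"
      unfolding sum_eq_split[OF z, of S] sum_eq_split[OF y'(1), of S]
      using tie[OF True] by (simp add: z_def)
    have "u w \<le> u y'" using mono_onD[OF u_mono] w y' by blast
    \<comment> \<open>The utilities of \<open>w\<close> and \<open>z\<close> bracket
      \<open>u y'\<close>, the level that belongs to the multiplier of \<open>y'\<close>, and
      neither endpoint exceeds \<open>y\<close> on \<open>S\<close>.\<close>
    define c where "c t = (1 - t) *\<^sub>R w + t *\<^sub>R z" for t :: real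
    have c: "c t \<in> {0..}" if "t \<in> {0..1}" for t
      using that w z by (auto simp: c_def vec_nonneg_iff)
    have "continuous_on {0..1} c" unfolding c_def by (intro continuous_intros)
    then have "continuous_on {0..1} (\<lambda>t. u (c t))"
      using c by (intro continuous_on_compose2[OF u_continuous]) auto
    then have "\<exists>t\<ge>0. t \<le> 1 \<and> u (c t) = u y'"
      using \<open>u w \<le> u y'\<close> \<open>u y' \<le> u z\<close> by (intro IVT') (auto simp: c_def)
    then obtain t where t: "0 \<le> t" "t \<le> 1" "u (c t) = u y'" by blast
    let ?l = "u y' / b'"
    let ?g = "\<lambda>x. u x - ?l * (q' \<bullet> x)"
    \<comment> \<open>Equal multipliers and equal prices give \<open>y\<close> and \<open>y'\<close>
      the same slopes on \<open>S\<close>, so their coordinates can be mixed there without leaving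
      the maximizers.\<close>
    have "y $ j \<in> lin_demand (v j) (?l * q' $ j)" if "j \<in> S" for j
      using y(3)[of j] S[OF that] True by simp
    then have "\<forall>j. w $ j \<in> lin_demand (v j) (?l * q' $ j)"
         "\<forall>j. z $ j \<in> lin_demand (v j) (?l * q' $ j)"
      using y'(3) by (simp_all add: w_def z_def min_def)
    then have max: "\<forall>x\<in>{0..}. ?g x \<le> ?g w" "\<forall>x\<in>{0..}. ?g x \<le> ?g z"
      using linear_maximizer_iff_lin_demand w z by blast+
    \<comment> \<open>Since \<open>?g\<close> is concave, its maximizers form a convex set, which
      contains the whole segment.\<close>
    have "?g x \<le> ?g (c t)" if "x \<in> {0..}" for x
    proof -
      have "?g x \<le> (1 - t) * ?g w + t * ?g z"
      proof -
        have "(1 - t) * ?g x \<le> (1 - t) * ?g w" "t * ?g x \<le> t * ?g z"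
          using max that t by (auto intro!: mult_left_mono)
        then show ?thesis by (simp add: left_diff_distrib)
      qed
      also have "\<dots> \<le> ?g (c t)"
      proof -
        have "q' \<bullet> c t = (1 - t) * (q' \<bullet> w) + t * (q' \<bullet> z)"
          by (simp add: c_def inner_add_right)
        then have "(1 - t) * ?g w + t * ?g z = (1 - t) * u w + t * u z - ?l * (q' \<bullet> c t)"
          by algebra
        then show ?thesis using u_concaveD[OF w(1) z, of t] t(1,2) by (simp add: c_def)
      qed
      finally show ?thesis .
    qed
    then have "\<forall>j. c t $ j \<in> lin_demand (v j) (?l * q' $ j)"
      using linear_maximizer_iff_lin_demand[of "c t" ?l q'] c[of t] t(1,2) by simp
    then have "c t \<in> gale_demand u q' b'"
      using gale_demand_iff[OF assms(2)] t y' c by auto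
    moreover have "c t $ j \<le> y $ j" if "j \<in> S" for j
    proof -
      have "w $ j \<le> y $ j" "z $ j \<le> y $ j" using w that by (auto simp: z_def)
      then show ?thesis
        using t convex_bound_le[of "w $ j" "y $ j" "z $ j" "1 - t" t] by (simp add: c_def)
    qed
    ultimately show ?thesis by blast
  qed
qed

text \<open>A smaller multiplier at the lower prices would make every nonzero slope strictly
  smaller, so that no \<open>v j\<close> loses value from \<open>y\<close> to \<open>y'\<close>,
  contradicting the drop in utility.\<close>

lemma gale_demand_lower_price:
  assumes b: "0 < b" and q: "0 \<le> q'" "q' \<le> q"
    and y: "y \<in> gale_demand u q b" and ex: "gale_demand u q' b \<noteq> {}"
  shows "\<exists>z\<in>gale_demand u q' b. \<forall>j. q' $ j = q $ j \<longrightarrow> z $ j \<le> y $ j"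
proof -
  obtain y' where y': "y' \<in> gale_demand u q' b" using ex by blast
  have Y: "y \<in> {0..}" "0 < u y" "\<And>j. y $ j \<in> lin_demand (v j) (u y / b * q $ j)"
    and Y': "y' \<in> {0..}" "0 < u y'" "\<And>j. y' $ j \<in> lin_demand (v j) (u y' / b * q' $ j)"
    using y y' gale_demand_iff b by blast+
  have q_nn: "0 \<le> q' $ j" "q' $ j \<le> q $ j" for j using q by (auto simp: less_eq_vec_def)
  have le: "u y \<le> u y'"
  proof (rule ccontr)
    assume "\<not> u y \<le> u y'"
    then have lt: "u y' / b < u y / b" using b by (simp add: divide_strict_right_mono)
    have "v j (y $ j) \<le> v j (y' $ j)" for j
    proof (rule lin_demand_value_antimono[OF Y'(3) Y(3) _ v_mono])
      have "u y' / b * q' $ j < u y / b * q $ j" if "q' $ j \<noteq> 0"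
        using that lt q_nn[of j] Y'(2) b by (intro mult_less_le_imp_less) auto
      then show "u y' / b * q' $ j < u y / b * q $ j \<or> u y' / b * q' $ j = 0" by auto
    qed
    then show False using \<open>\<not> u y \<le> u y'\<close> Y Y' by (simp add: sum_eq sum_mono)
  qed
  define S where "S = {j. q' $ j = q $ j}"
  have "\<exists>z\<in>gale_demand u q' b. \<forall>j\<in>S. z $ j \<le> y $ j"
  proof (rule gale_demand_lowerI[OF b b y y' q_nn(1)])
    show "u y / b \<le> u y' / b" using le b by (simp add: divide_right_mono)
    assume "u y / b = u y' / b"
    then have eq: "u y = u y'" using b by simp
    \<comment> \<open>Goods outside \<open>S\<close> become strictly cheaper and do not lose value.
      As the total utility is unchanged, the total value on \<open>S\<close> cannot grow, which is
      the tie condition.\<close>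
    have "v j (y $ j) \<le> v j (y' $ j)" if "j \<in> -S" for j
    proof (rule lin_demand_value_antimono[OF Y'(3) Y(3) _ v_mono])
      have "q' $ j < q $ j" using that q_nn(2)[of j] by (simp add: S_def)
      then show "u y' / b * q' $ j < u y / b * q $ j \<or> u y' / b * q' $ j = 0"
        unfolding eq using Y' b by (intro disjI1 mult_strict_left_mono) auto
    qed
    then have "(\<Sum>j\<in>-S. v j (y $ j)) \<le> (\<Sum>j\<in>-S. v j (y' $ j))" by (rule sum_mono)
    then show "(\<Sum>j\<in>S. v j (y' $ j)) \<le> (\<Sum>j\<in>S. v j (y $ j))"
      using eq sum_eq_split[OF Y(1), of S] sum_eq_split[OF Y'(1), of S] by simp
  qed (simp add: S_def)
  then show ?thesis by (auto simp: S_def)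
qed

text \<open>A smaller multiplier would again give \<open>u y <= u y'\<close>, and dividing by
  \<open>b' <= b\<close> contradicts it. Equal multipliers force
  \<open>u y' = b' / b * u y <= u y\<close>, the tie condition with all goods in
  \<open>S\<close>.\<close>

lemma gale_demand_lower_budget:
  assumes b: "0 < b'" "b' \<le> b" and q: "0 \<le> q"
    and y: "y \<in> gale_demand u q b" and ex: "gale_demand u q b' \<noteq> {}"
  shows "\<exists>z\<in>gale_demand u q b'. z \<le> y"
proof -
  obtain y' where y': "y' \<in> gale_demand u q b'" using ex by blast
  have b0: "0 < b" using b by simp
  have Y: "y \<in> {0..}" "0 < u y" "\<And>j. y $ j \<in> lin_demand (v j) (u y / b * q $ j)"
    and Y': "y' \<in> {0..}" "0 < u y'" "\<And>j. y' $ j \<in> lin_demand (v j) (u y' / b' * q $ j)"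
    using y y' gale_demand_iff b b0 by blast+
  have q_nn: "0 \<le> q $ j" for j using q by (auto simp: less_eq_vec_def)
  have le: "u y / b \<le> u y' / b'"
  proof (rule ccontr)
    assume "\<not> ?thesis"
    then have lt: "u y' / b' < u y / b" by simp
    have "v j (y $ j) \<le> v j (y' $ j)" for j
    proof (rule lin_demand_value_antimono[OF Y'(3) Y(3) _ v_mono])
      show "u y' / b' * q $ j < u y / b * q $ j \<or> u y' / b' * q $ j = 0"
        using mult_strict_right_mono[OF lt] q_nn[of j] by (cases "q $ j = 0") (simp_all add: order_less_le)
    qed
    then have "u y \<le> u y'" using Y Y' by (simp add: sum_eq sum_mono)
    then have "u y / b \<le> u y' / b'" using b Y by (intro frac_le) auto
    then show False using lt by simp
  qed
  have "\<exists>z\<in>gale_demand u q b'. \<forall>j\<in>UNIV. z $ j \<le> y $ j"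
  proof (rule gale_demand_lowerI[OF b0 b(1) y y' q_nn _ le])
    assume "u y / b = u y' / b'"
    then have "u y' = b' * (u y / b)" using b by simp
    also have "\<dots> \<le> b * (u y / b)" using b b0 Y by (intro mult_right_mono) auto
    finally have "u y' \<le> u y" using b0 by simp
    then show "(\<Sum>j\<in>UNIV. v j (y' $ j)) \<le> (\<Sum>j\<in>UNIV. v j (y $ j))"
      using Y Y' by (simp add: sum_eq)
  qed simp
  then show ?thesis by (auto simp: less_eq_vec_def)
qed

text \<open>At zero prices each \<open>y $ j\<close> maximizes \<open>v j\<close>. Cutting any
  demand at \<open>q\<close> down to \<open>y\<close> thus loses no utility and does not raise the
  cost, so it remains a demand.\<close>

lemma gale_demand_le_zero_price:
  assumes b: "0 < b" and q: "0 \<le> q" and y: "y \<in> gale_demand u 0 b"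
    and ex: "gale_demand u q b \<noteq> {}"
  shows "\<exists>z\<in>gale_demand u q b. z \<le> y"
proof -
  obtain x where x: "x \<in> gale_demand u q b" using ex by blast
  have X: "x \<in> {0..}" "0 < u x" "\<forall>z\<in>{0..}. u z * exp (- (q \<bullet> z) / b) \<le> u x * exp (- (q \<bullet> x) / b)"
    using x gale_demand_iff_exp[OF b] by blast+
  have Y: "y \<in> {0..}" "\<And>j. y $ j \<in> lin_demand (v j) 0"
    using y gale_demand_iff[OF b] by auto
  have q_nn: "0 \<le> q $ j" for j using q by (auto simp: less_eq_vec_def)
  define w where "w = (\<chi> j. min (x $ j) (y $ j))"
  have w: "w \<in> {0..}" "w \<le> y" using X Y by (auto simp: w_def vec_nonneg_iff less_eq_vec_def)
  have "v j (x $ j) \<le> v j (w $ j)" for j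
    using X(1) Y(2)[of j] by (auto simp: w_def min_def lin_demand_def vec_nonneg_iff)
  then have "u x \<le> u w" using X w by (simp add: sum_eq sum_mono)
  have "q \<bullet> w \<le> q \<bullet> x"
    unfolding inner_vec_sum using q_nn by (intro sum_mono mult_left_mono) (auto simp: w_def)
  then have "u x * exp (- (q \<bullet> x) / b) \<le> u w * exp (- (q \<bullet> w) / b)"
    using \<open>u x \<le> u w\<close> X b by (intro mult_mono) (auto simp: divide_right_mono)
  then have "w \<in> gale_demand u q b"
    using w X \<open>u x \<le> u w\<close> unfolding gale_demand_iff_exp[OF b] by force
  then show ?thesis using w by blast
qed

section \<open>Existence of Gale demand\<close>

text \<open>A free good is cut at a point where \<open>v j\<close> is maximal. For a priced good,
  spending beyond the whole budget \<open>b\<close> on it never pays: the utility shrinks by at most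
  a factor \<open>r\<close>, while the saving contributes the factor
  \<open>exp (r - 1) >= r\<close>.\<close>

lemma exp_objective_le_clip:
  assumes b: "0 < b" and x: "x \<in> {0..}"
    and T: "q $ j = 0 \<Longrightarrow> 0 \<le> T \<and> (\<forall>t\<ge>0. v j t \<le> v j T)" "q $ j \<noteq> 0 \<Longrightarrow> 0 < q $ j \<and> T = b / q $ j"
    and y: "y = (\<chi> i. if i = j then min (x $ j) T else x $ i)"
  shows "u x * exp (- (q \<bullet> x) / b) \<le> u y * exp (- (q \<bullet> y) / b)"
proof (cases "x $ j \<le> T")
  case True
  then have "y = x" using y by (auto simp: vec_eq_iff)
  then show ?thesis by simp
next
  case False
  then have lt: "T < x $ j" by simp
  have T0: "0 \<le> T" using T b by (cases "q $ j = 0") auto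
  have y0: "y \<in> {0..}" using x T0 by (auto simp: y vec_nonneg_iff)
  have yj: "y $ j = T" using lt by (simp add: y)
  have yi: "y $ i = x $ i" if "i \<noteq> j" for i using that by (simp add: y)
  have u_split: "u z = v j (z $ j) + (\<Sum>i\<in>UNIV - {j}. v i (z $ i))" if "z \<in> {0..}" for z
    using that by (simp add: sum_eq sum.remove)
  have q_split: "q \<bullet> z = q $ j * z $ j + (\<Sum>i\<in>UNIV - {j}. q $ i * z $ i)" for z
    by (simp add: inner_vec_sum sum.remove)
  have rest: "(\<Sum>i\<in>UNIV - {j}. f i (y $ i)) = (\<Sum>i\<in>UNIV - {j}. f i (x $ i))" for f :: "'m \<Rightarrow> real \<Rightarrow> real"
    using yi by (intro sum.cong) auto
  have q_eq: "q \<bullet> x = q \<bullet> y + q $ j * (x $ j - T)"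
    using q_split[of x] q_split[of y] rest[of "\<lambda>i t. q $ i * t"] yj by (simp add: algebra_simps)
  show ?thesis
  proof (cases "q $ j = 0")
    case True
    then have "u x \<le> u y"
      using u_split[OF x] u_split[OF y0] rest[of v] T(1) yj x by (simp add: vec_nonneg_iff)
    then show ?thesis using q_eq True by simp
  next
    case False
    then have qj: "0 < q $ j" "T = b / q $ j" using T by auto
    then have Tpos: "0 < T" using b by simp
    \<comment> \<open>Scaling \<open>x\<close> by \<open>1 / r\<close> brings good \<open>j\<close>
      exactly to the cap and stays below \<open>y\<close>; concavity on the ray from 0 with
      \<open>u 0 = 0\<close> then gives \<open>u x <= r * u y\<close>.\<close>
    define r where "r = x $ j / T"
    have r: "1 < r" using lt Tpos by (simp add: r_def)
    have "(1 - 1 / r) * u 0 + 1 / r * u x \<le> u ((1 - 1 / r) *\<^sub>R 0 + (1 / r) *\<^sub>R x)"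
      using r x by (intro u_concaveD) auto
    also have "\<dots> \<le> u y"
    proof (rule mono_onD[OF u_mono])
      show "(1 - 1 / r) *\<^sub>R 0 + (1 / r) *\<^sub>R x \<le> y"
        unfolding less_eq_vec_def
      proof
        fix i
        have "x $ i / r \<le> x $ i" using r x mult_right_mono[of 1 r "x $ i"] by (simp add: vec_nonneg_iff field_simps)
        moreover have "x $ j / r = T" using r Tpos lt by (simp add: r_def)
        ultimately show "((1 - 1 / r) *\<^sub>R 0 + (1 / r) *\<^sub>R x) $ i \<le> y $ i"
          using yi[of i] yj by (cases "i = j") auto
      qed
    qed (use x y0 r in \<open>auto simp: vec_nonneg_iff\<close>)
    finally have "1 / r * u x \<le> u y" using utility by (simp add: utility_def)
    then have "u x \<le> u y * r" using r by (simp add: field_simps)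
    also have "\<dots> \<le> u y * exp (r - 1)"
      using exp_ge_add_one_self[of "r - 1"] u_nonneg[OF y0] by (intro mult_left_mono) auto
    finally have "u x * exp (- (q \<bullet> x) / b) \<le> u y * exp (r - 1) * exp (- (q \<bullet> x) / b)" by simp
    also have "\<dots> = u y * exp ((r - 1) + - (q \<bullet> x) / b)" by (simp only: exp_add mult.assoc)
    \<comment> \<open>Because \<open>q $ j * T = b\<close>, the number \<open>r - 1\<close> is
      exactly the saved cost over \<open>b\<close>.\<close>
    also have "(r - 1) + - (q \<bullet> x) / b = - (q \<bullet> y) / b"
    proof -
      have "r = q $ j * x $ j / b" "q $ j * T = b" using qj by (simp_all add: r_def)
      then show ?thesis using b by (simp add: q_eq field_simps)
    qed
    finally show ?thesis .
  qed
qed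

text \<open>Clipping the goods one after another confines the maximization to a compact box, on
  which the continuous objective attains its supremum.\<close>

lemma gale_demand_nonempty:
  assumes b: "0 < b" and q: "0 \<le> q"
    and sat: "\<And>j. q $ j = 0 \<Longrightarrow> \<exists>T\<ge>0. \<forall>t\<ge>0. v j t \<le> v j T"
  shows "gale_demand u q b \<noteq> {}"
proof -
  let ?F = "\<lambda>x. u x * exp (- (q \<bullet> x) / b)"
  have "\<exists>T. (q $ j = 0 \<longrightarrow> 0 \<le> T \<and> (\<forall>t\<ge>0. v j t \<le> v j T)) \<and>
      (q $ j \<noteq> 0 \<longrightarrow> 0 < q $ j \<and> T = b / q $ j)" for j
  proof (cases "q $ j = 0")
    case True
    then show ?thesis using sat[of j] by auto
  next
    case False
    then have "0 < q $ j" using q by (simp add: less_eq_vec_def order_less_le)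
    then show ?thesis by auto
  qed
  then obtain T where T: "\<And>j. q $ j = 0 \<Longrightarrow> 0 \<le> T j \<and> (\<forall>t\<ge>0. v j t \<le> v j (T j))"
    "\<And>j. q $ j \<noteq> 0 \<Longrightarrow> 0 < q $ j \<and> T j = b / q $ j" by metis
  have T0: "0 \<le> T j" for j using T[of j] b by (cases "q $ j = 0") auto
  have clip: "?F x \<le> ?F (\<chi> i. if i \<in> A then min (x $ i) (T i) else x $ i)"
    if x: "x \<in> {0..}" and "finite A" for x A
    using \<open>finite A\<close>
  proof (induction A rule: finite_induct)
    case (insert j A)
    let ?x = "\<lambda>A. \<chi> i. if i \<in> A then min (x $ i) (T i) else x $ i"
    have "?F (?x A) \<le> ?F (?x (insert j A))"
    proof (rule exp_objective_le_clip[OF b _ T(1) T(2)])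
      show "?x A \<in> {0..}" using x T0 by (auto simp: vec_nonneg_iff)
      show "?x (insert j A) = (\<chi> i. if i = j then min (?x A $ j) (T j) else ?x A $ i)"
        using insert.hyps by (auto simp: vec_eq_iff)
    qed auto
    then show ?case using insert.IH by linarith
  qed simp
  let ?B = "cbox 0 (\<chi> j. T j)"
  have B: "x \<in> ?B \<longleftrightarrow> (\<forall>j. 0 \<le> x $ j \<and> x $ j \<le> T j)" for x
    by (auto simp: mem_box_cart)
  have "continuous_on ?B u" by (rule continuous_on_subset[OF u_continuous]) (auto simp: B vec_nonneg_iff)
  then have "continuous_on ?B ?F" using b by (intro continuous_intros) auto
  moreover have "0 \<in> ?B" using T0 by (simp add: B)
  ultimately obtain y where y: "y \<in> ?B" "\<And>x. x \<in> ?B \<Longrightarrow> ?F x \<le> ?F y"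
    using continuous_attains_sup[of ?B ?F] compact_cbox by blast
  have max: "?F x \<le> ?F y" if "x \<in> {0..}" for x
  proof -
    have "?F x \<le> ?F (\<chi> i. if i \<in> UNIV then min (x $ i) (T i) else x $ i)"
      using clip[OF that, of UNIV] by simp
    also have "\<dots> \<le> ?F y" using that T0 by (intro y(2)) (auto simp: B vec_nonneg_iff)
    finally show ?thesis .
  qed
  obtain w where w: "w \<in> {0..}" "0 < u w" using u_pos_ex by blast
  then have "0 < ?F y" using max[OF w(1)] by (smt (verit) exp_gt_zero mult_pos_pos)
  then have "0 < u y" by (simp add: zero_less_mult_iff)
  then have "y \<in> gale_demand u q b"
    using max y(1) by (auto simp: gale_demand_iff_exp[OF b] B less_eq_vec_def)
  then show ?thesis by blast
qed

text \<open>Bundles consisting of good \<open>j\<close> alone cost nothing, so on them the objective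
  is \<open>b * ln (v j t)\<close>, and its finite supremum bounds \<open>v j\<close>.\<close>

lemma pdom_zero_price_bounded:
  assumes "q \<in> pdom u" "q $ j = 0"
  shows "\<exists>C. \<forall>t\<ge>0. v j t \<le> C"
proof -
  obtain b where b: "0 < b" "(SUP y\<in>{0..}. gale_objective u q b y) < \<infinity>"
    using assms by (auto simp: pdom_def)
  then obtain C :: real where C: "(SUP y\<in>{0..}. gale_objective u q b y) \<le> ereal C"
    using less_PInf_Ex_of_nat[of "SUP y\<in>{0..}. gale_objective u q b y"]
      by (auto intro: order_less_imp_le)
  have "v j t \<le> exp (C / b)" if t: "0 \<le> t" for t
  proof (cases "v j t > 0")
    case True
    have "axis j t \<in> {0..}" using t by (auto simp: vec_nonneg_iff axis_def)
    then have "gale_objective u q b (axis j t) \<le> ereal C" using C by (auto simp: SUP_le_iff)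
    then have "b * ln (v j t) \<le> C"
      using True t b assms by (simp add: gale_objective_eq u_axis inner_axis)
    then have "ln (v j t) \<le> C / b" using b by (simp add: field_simps)
    then show ?thesis using True by (metis exp_le_cancel_iff exp_ln)
  next
    case False
    then show ?thesis by (smt (verit) exp_gt_zero)
  qed
  then show ?thesis by blast
qed

text \<open>The price vector charging every good except \<open>j\<close> forces the bundle provided by the
  attainment assumption to be a multiple of the good \<open>j\<close>.\<close>

lemma bounded_imp_attains:
  assumes att: "attainment u" and C: "\<forall>t\<ge>0. v j t \<le> C"
  shows "\<exists>T\<ge>0. \<forall>t\<ge>0. v j t \<le> v j T"
proof -
  define p :: "real ^ 'm" where "p = (\<chi> i. if i = j then 0 else 1)"
  \<comment> \<open>The integer quantities of good \<open>j\<close> cost nothing at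
    \<open>p\<close>, and their utilities increase to the supremum \<open>M\<close> of
    \<open>v j\<close>; attainment applies with budget 0.\<close>
  have "incseq (\<lambda>k. v j (real k))"
    by (auto simp: incseq_def intro!: mono_onD[OF v_mono])
  then obtain M where M: "(\<lambda>k. v j (real k)) \<longlonglongrightarrow> M" "\<forall>k. v j (real k) \<le> M"
    using incseq_convergent[of "\<lambda>k. v j (real k)" C] C by auto
  have "p \<bullet> axis j (real k) = 0" "axis j (real k) \<in> {0..}" "0 \<le> p" for k
    by (simp_all add: p_def inner_axis) (simp_all add: vec_nonneg_iff axis_def)
  then have "\<exists>x\<in>{0..}. u x = M \<and> p \<bullet> x \<le> 0"
    using M(1) by (intro att[unfolded attainment_def, rule_format, of p 0 "\<lambda>k. axis j (real k)"])
      (simp_all add: u_axis)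
  then obtain x where x: "x \<in> {0..}" "u x = M" "p \<bullet> x \<le> 0" by blast
  have nn: "0 \<le> p $ i * x $ i" for i using x by (simp add: p_def vec_nonneg_iff)
  then have "(\<Sum>i\<in>UNIV. p $ i * x $ i) = 0"
    using x(3) by (simp add: inner_vec_sum sum_nonneg antisym)
  then have px: "p $ i * x $ i = 0" for i using nn by (simp add: sum_nonneg_eq_0_iff)
  then have "x $ i = 0" if "i \<noteq> j" for i using px[of i] that by (simp add: p_def)
  then have "x = axis j (x $ j)" by (auto simp: vec_eq_iff axis_def)
  then have "v j (x $ j) = M" using x u_axis[of "x $ j" j] by (simp add: vec_nonneg_iff)
  moreover have "v j t \<le> M" if "0 \<le> t" for t
  proof -
    obtain k :: nat where "t \<le> real k" using real_arch_simple by blast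
    then have "v j t \<le> v j (real k)" using that by (intro mono_onD[OF v_mono]) auto
    then show ?thesis using M(2) order_trans by blast
  qed
  ultimately show ?thesis using x by (auto simp: vec_nonneg_iff)
qed

text \<open>A good that is free at \<open>q\<close> is also free at \<open>q'\<close>, hence its
  \<open>v j\<close> is bounded and attains its supremum. The case \<open>q = q'\<close> serves the
  price and budget conditions, the case \<open>q' = 0\<close> the comparison with zero
  prices.\<close>

lemma gale_demand_nonempty_above_pdom:
  assumes "attainment u" "0 < b" "q' \<in> pdom u" "q' \<le> q"
  shows "gale_demand u q b \<noteq> {}"
proof (rule gale_demand_nonempty[OF assms(2)])
  have q': "0 \<le> q'" using assms(3) by (simp add: pdom_def)
  then show "0 \<le> q" using assms(4) by simp
  fix j assume "q $ j = 0"
  then have "q' $ j = 0" using q' assms(4) by (metis less_eq_vec_def antisym zero_index)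
  then show "\<exists>T\<ge>0. \<forall>t\<ge>0. v j t \<le> v j T"
    using pdom_zero_price_bounded bounded_imp_attains assms by blast
qed

lemma sigma_gale_substitutes:
  assumes "attainment u"
  shows "sigma_gale_substitutes u"
  unfolding sigma_gale_substitutes_def gale_substitutes_def
proof (intro conjI allI ballI impI)
  note ex = gale_demand_nonempty_above_pdom[OF assms]
  have pd: "0 \<le> q" if "q \<in> pdom u" for q using that by (simp add: pdom_def)
  show "\<exists>y'\<in>gale_demand u q' b. \<forall>j. q' $ j = q $ j \<longrightarrow> y' $ j \<le> y $ j"
    if "0 < b" "q \<in> pdom u" "q' \<in> pdom u" "q' \<le> q" "y \<in> gale_demand u q b" for b q q' y
    using gale_demand_lower_price[OF that(1) pd[OF that(3)] that(4,5)] ex[OF that(1,3)] by simp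
  show "\<exists>y'\<in>gale_demand u q b'. y' \<le> y"
    if "b' \<le> b \<and> 0 < b'" "q \<in> pdom u" "y \<in> gale_demand u q b" for b b' q y
    using gale_demand_lower_budget[of b' b q y] ex[of b' q q] pd[of q] that by simp
  show "\<exists>y'\<in>gale_demand u q b. y' \<le> y"
    if "0 \<in> pdom u" "0 < b" "q \<in> {0..}" "y \<in> gale_demand u 0 b" for b q y
    using gale_demand_le_zero_price[of b q y] ex[of b 0 q] that by auto
qed

end

theorem theorem1p4:
  fixes u :: "real ^ 'm::finite \<Rightarrow> real"
  assumes "utility u"
    and "separable u"
    and "attainment u"
  shows "sigma_gale_substitutes u"
proof -
  obtain w :: "'m \<Rightarrow> real \<Rightarrow> real" where w: "\<And>x. x \<in> {0..} \<Longrightarrow> u x = (\<Sum>j\<in>UNIV. w j (x $ j))"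
    using assms(2) by (auto simp: separable_def)
  have "(\<Sum>j\<in>UNIV. w j 0) = 0" using w[of 0] assms(1) by (simp add: utility_def)
  \<comment> \<open>The constants \<open>w j 0\<close> add up to \<open>u 0 = 0\<close>, so
    subtracting them normalizes the summands without changing \<open>u\<close>.\<close>
  then interpret separable_utility u "\<lambda>j t. w j t - w j 0"
    by unfold_locales (use assms(1) w in \<open>auto simp: sum_subtractf\<close>)
  show ?thesis using sigma_gale_substitutes[OF assms(3)] .
qed

end
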